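(* Let $X$ be a nonempty locally compact Hausdorff space and let $Y$ be a locally convex topological vector space over $\mathbb{R}$ or $\mathbb{C}$ with at least two points, equipped with a compatible metric $d$. If the metric $d$ on $Y$ is complete, then the following assertions are equivalent: (1) $MC(X,Y)$ is locally compact; (2) $MC(X,Y)$ is $\sigma$-compact; (3) $MC(X,Y)$ is locally $\sigma$-compact; (4) $Y$ is finite-dimensional and $X$ is finite.
   Context: A map (multifunction) $F\colon X\to Y$ assigns to each $x\in X$ a subset $F(x)\subseteq Y$; for $A\subseteq X$ put $F(A)=\bigcup_{x\in A}F(x)$. Maps are identified with their graphs $\{(x,y): y\in F(x)\}$. $F$ is upper semicontinuous if for every $x\in X$ and every open $V\supseteq F(x)$ there is an open $U\ni x$ with $F(U)\subseteq V$. $F$ is usco if it is upper semicontinuous and every $F(x)$ is a nonempty compact set. $F$ is cusco if it is usco and every $F(x)$ is convex. $F$ is minimal cusco if it is cusco and its graph does not properly contain the graph of any other cusco map from $X$ to $Y$. $MC(X,Y)$ is the set of all minimal cusco maps from $X$ to $Y$. Let $K(Y)$ be the set of nonempty compact subsets of $Y$, and $H_d$ the Hausdorff metric on $K(Y)$. On $K(Y)^X$ the topology $\tau_{uc}$ of uniform convergence on compact sets is induced by the uniformity $\mathcal U_{uc}$ with base consisting of the sets $W[K,\varepsilon]=\{(F,G): H_d(F(x),G(x))<\varepsilon \text{ for every } x\in K\}$, where $K\subseteq X$ is compact and $\varepsilon>0$. $MC(X,Y)\subseteq K(Y)^X$ carries the subspace topology of $\tau_{uc}$. A space is locally $\sigma$-compact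 if each of its points has a neighborhood that is a $\sigma$-compact subspace. *)

theory Defs
  imports "HOL-Analysis.Analysis"
begin

section \<open>Locally convex topological vector spaces\<close>

text \<open>
  The scalar field is the type variable \<open>'k\<close>, to be instantiated with \<^typ>\<open>real\<close> or \<^typ>\<open>complex\<close>.
  Continuity of addition and of negation is the class \<^class>\<open>topological_ab_group_add\<close>.  The
  underlying real vector space structure (which defines \<^const>\<open>convex\<close>) is the class
  \<^class>\<open>real_vector\<close>; it has to be the restriction of \<open>scl\<close> to the reals.  On a type of class
  \<^class>\<open>metric_space\<close> the topology is the one induced by \<^const>\<open>dist\<close>, so that \<^const>\<open>dist\<close> is
  a compatible metric; it need not be translation invariant.
\<close>

definition locally_convex_tvs ::
    "('k::real_normed_field \<Rightarrow> 'y \<Rightarrow> 'y::{real_vector, topological_ab_group_add}) \<Rightarrow> bool" where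
  "locally_convex_tvs scl \<longleftrightarrow>
     vector_space scl \<and>
     (\<forall>r x. scl (of_real r) x = r *\<^sub>R x) \<and>
     continuous_on UNIV (\<lambda>(a, x). scl a x) \<and>
     (\<forall>U :: 'y set. open U \<and> 0 \<in> U \<longrightarrow> (\<exists>V. open V \<and> convex V \<and> 0 \<in> V \<and> V \<subseteq> U))"

definition finite_dimensional :: "('k::field \<Rightarrow> 'y \<Rightarrow> 'y::ab_group_add) \<Rightarrow> bool" where
  "finite_dimensional scl \<longleftrightarrow> (\<exists>Basis. finite_dimensional_vector_space scl Basis)"


section \<open>Set-valued maps\<close>

definition set_graph :: "('x \<Rightarrow> 'y set) \<Rightarrow> ('x \<times> 'y) set" where
  "set_graph F = {(x, y). y \<in> F x}"

definition upper_semicontinuous ::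
    "('x::topological_space \<Rightarrow> 'y::topological_space set) \<Rightarrow> bool" where
  "upper_semicontinuous F \<longleftrightarrow>
     (\<forall>x V. open V \<and> F x \<subseteq> V \<longrightarrow> (\<exists>U. open U \<and> x \<in> U \<and> (\<Union>u\<in>U. F u) \<subseteq> V))"

definition usco :: "('x::topological_space \<Rightarrow> 'y::topological_space set) \<Rightarrow> bool" where
  "usco F \<longleftrightarrow> upper_semicontinuous F \<and> (\<forall>x. F x \<noteq> {} \<and> compact (F x))"

definition cusco ::
    "('x::topological_space \<Rightarrow> 'y::{real_vector, topological_space} set) \<Rightarrow> bool" where
  "cusco F \<longleftrightarrow> usco F \<and> (\<forall>x. convex (F x))"

definition minimal_cusco ::
    "('x::topological_space \<Rightarrow> 'y::{real_vector, topological_space} set) \<Rightarrow> bool" where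
  "minimal_cusco F \<longleftrightarrow> cusco F \<and> \<not> (\<exists>G. cusco G \<and> set_graph G \<subset> set_graph F)"


section \<open>Uniform convergence on compact sets\<close>

text \<open>Only meaningful for nonempty bounded sets, in particular for nonempty compact ones.\<close>

definition Hausdorff_dist :: "'y::metric_space set \<Rightarrow> 'y set \<Rightarrow> real" where
  "Hausdorff_dist A B = max (SUP a\<in>A. infdist a B) (SUP b\<in>B. infdist b A)"

definition compact_valued :: "('x \<Rightarrow> 'y::topological_space set) set" where
  "compact_valued = {F. \<forall>x. F x \<noteq> {} \<and> compact (F x)}"

definition uc_entourage ::
    "'x set \<Rightarrow> real \<Rightarrow> (('x \<Rightarrow> 'y::metric_space set) \<times> ('x \<Rightarrow> 'y set)) set" where
  "uc_entourage K e =
     {(F, G). F \<in> compact_valued \<and> G \<in> compact_valued \<and> (\<forall>x\<in>K. Hausdorff_dist (F x) (G x) < e)}"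

text \<open>
  The topology induced by the uniformity on \<^const>\<open>compact_valued\<close> with base \<^const>\<open>uc_entourage\<close>.
\<close>

definition tau_uc :: "('x::topological_space \<Rightarrow> 'y::metric_space set) topology" where
  "tau_uc = topology (\<lambda>\<U>. \<U> \<subseteq> compact_valued \<and>
     (\<forall>F\<in>\<U>. \<exists>K e. compact K \<and> 0 < e \<and> uc_entourage K e `` {F} \<subseteq> \<U>))"

lemma openin_tau_uc:
  fixes \<U> :: "('x::topological_space \<Rightarrow> 'y::metric_space set) set"
  shows "openin tau_uc \<U> \<longleftrightarrow> \<U> \<subseteq> compact_valued \<and>
     (\<forall>F\<in>\<U>. \<exists>K e. compact K \<and> 0 < e \<and> uc_entourage K e `` {F} \<subseteq> \<U>)"
proof -
  have "istopology (\<lambda>\<U> :: ('x \<Rightarrow> 'y set) set.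
     \<U> \<subseteq> compact_valued \<and>
     (\<forall>F\<in>\<U>. \<exists>K e. compact K \<and> 0 < e \<and> uc_entourage K e `` {F} \<subseteq> \<U>))"
    unfolding istopology_def
  proof (rule conjI; intro allI impI conjI ballI)
    fix S T :: "('x \<Rightarrow> 'y set) set" and F
    assume S: "S \<subseteq> compact_valued \<and>
        (\<forall>F\<in>S. \<exists>K e. compact K \<and> 0 < e \<and> uc_entourage K e `` {F} \<subseteq> S)"
      and T: "T \<subseteq> compact_valued \<and>
        (\<forall>F\<in>T. \<exists>K e. compact K \<and> 0 < e \<and> uc_entourage K e `` {F} \<subseteq> T)"
    show "S \<inter> T \<subseteq> compact_valued"
      using S by blast
    assume F: "F \<in> S \<inter> T"
    obtain K e where 1: "compact K" "0 < e" "uc_entourage K e `` {F} \<subseteq> S"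
      using S F by blast
    obtain L d where 2: "compact L" "0 < d" "uc_entourage L d `` {F} \<subseteq> T"
      using T F by blast
    have "uc_entourage (K \<union> L) (min e d) `` {F} \<subseteq> S \<inter> T"
      using 1(3) 2(3) by (auto simp: uc_entourage_def)
    with 1 2 show "\<exists>K e. compact K \<and> 0 < e \<and> uc_entourage K e `` {F} \<subseteq> S \<inter> T"
      by (intro exI[of _ "K \<union> L"] exI[of _ "min e d"]) auto
  next
    fix \<K> :: "('x \<Rightarrow> 'y set) set set"
    assume *: "\<forall>S\<in>\<K>. S \<subseteq> compact_valued \<and>
        (\<forall>F\<in>S. \<exists>K e. compact K \<and> 0 < e \<and> uc_entourage K e `` {F} \<subseteq> S)"
    show "\<Union>\<K> \<subseteq> compact_valued"
      using * by blast
    fix F assume "F \<in> \<Union>\<K>"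
    then obtain S where "S \<in> \<K>" "F \<in> S" by blast
    with * show "\<exists>K e. compact K \<and> 0 < e \<and> uc_entourage K e `` {F} \<subseteq> \<Union>\<K>"
      by (meson Union_upper order_trans)
  qed
  then show ?thesis
    unfolding tau_uc_def by (simp only: topology_inverse')
qed

lemma topspace_tau_uc: "topspace tau_uc = compact_valued"
proof -
  have "openin tau_uc (compact_valued :: ('x::topological_space \<Rightarrow> 'y::metric_space set) set)"
    unfolding openin_tau_uc
    by (auto simp: uc_entourage_def intro!: exI[of _ "{}"] exI[of _ "1::real"])
  then show ?thesis
    by (meson openin_subset openin_tau_uc openin_topspace subset_antisym)
qed

definition MC_space ::
    "('x::topological_space \<Rightarrow> 'y::{real_vector, metric_space} set) topology" where
  "MC_space = subtopology tau_uc {F. minimal_cusco F}"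

lemma topspace_MC_space: "topspace MC_space = {F. minimal_cusco F}"
  by (auto simp: MC_space_def topspace_tau_uc compact_valued_def minimal_cusco_def
      cusco_def usco_def)


section \<open>Sigma-compactness\<close>

definition sigma_compact_space :: "'a topology \<Rightarrow> bool" where
  "sigma_compact_space T \<longleftrightarrow>
     (\<exists>\<K>. countable \<K> \<and> (\<forall>K\<in>\<K>. compactin T K) \<and> \<Union>\<K> = topspace T)"

definition locally_sigma_compact_space :: "'a topology \<Rightarrow> bool" where
  "locally_sigma_compact_space T \<longleftrightarrow>
     (\<forall>x\<in>topspace T. \<exists>U N. openin T U \<and> x \<in> U \<and> U \<subseteq> N \<and> N \<subseteq> topspace T \<and>
        sigma_compact_space (subtopology T N))"

end

theory Submission
  imports Defs
begin

text \<open>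
  Both local compactness and \<open>\<sigma>\<close>-compactness imply local \<open>\<sigma>\<close>-compactness, so the content lies in
  two implications.

  \<^emph>\<open>From finiteness to compactness.\<close>  A finite Hausdorff space is discrete, and over a discrete
  domain a minimal cusco map has one-point values: any selection is continuous and therefore already
  a cusco map.  For finite \<open>X\<close> the space \<open>MC(X,Y)\<close> is thus homeomorphic to the finite power \<open>Y\<^sup>X\<close>
  (\<open>MC_space_finite_domain_homeomorphic\<close>).  A finite-dimensional \<open>Y\<close> is a countable union of
  compact sets.  As the metric is complete, Baire's theorem gives one of these sets an interior
  point, and translations spread this compact neighbourhood over \<open>Y\<close>.  So \<open>Y\<close> is \<open>\<sigma>\<close>-compact and
  locally compact, and both properties pass to the finite power.

  \<^emph>\<open>From local \<open>\<sigma>\<close>-compactness to finiteness.\<close>  Some basic neighbourhood of the zero map is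
  covered by countably many compact sets \<open>\<K> i\<close> of maps.

  The constant maps form a closed copy of \<open>Y\<close> in \<open>MC(X,Y)\<close>, so a ball in \<open>Y\<close> is covered by countably
  many compact sets.  By Baire's theorem and translation \<open>Y\<close> is locally compact, and Riesz's argument
  (\<open>finite_span_if_locally_compact\<close>) makes it finite-dimensional.

  If \<open>X\<close> is infinite, a diagonal argument produces a continuous function in the neighbourhood which
  is in no \<open>\<K> i\<close>.  When \<open>X\<close> is discrete, the neighbourhood restricts only finitely many
  values; at the \<open>i\<close>-th of infinitely many other points one chooses a value which no map in \<open>\<K> i\<close>
  takes, possible since \<open>Y\<close> is not compact.  When \<open>X\<close> has an accumulation point, there are points
  \<open>x n\<close> in a compact set \<open>C\<close> and bump functions at these points, built on disjoint open sets.  Here the key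
  fact is \<open>sequences_tend_uniformly_on_compact_family\<close>: the functions in \<open>\<K> i\<close> which tend to \<open>0\<close> along
  \<open>x\<close> do so at a common rate.  A small sum of multiples of bump functions which tends to \<open>0\<close> along
  \<open>x\<close>, but at some point \<open>x n\<close> exceeds what the rate for \<open>\<K> i\<close> permits, for each \<open>i\<close>, is in the
  neighbourhood and in no \<open>\<K> i\<close>.

  A complex vector space enters only through its real scalar multiplication, except that finite
  dimension refers to the given scalars: a finite set spanning \<open>Y\<close> over the reals spans it
  over the given field, and the covering by compact sets is built over that field directly.
\<close>

section \<open>Baire's theorem and translations\<close>

lemma compact_cover_of_ball_has_interior:
  fixes L :: "nat \<Rightarrow> 'y::metric_space set"
  assumes "complete (UNIV :: 'y set)" "\<And>i. compact (L i)" "0 < e" "ball a e \<subseteq> (\<Union>i. L i)"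
  shows "\<exists>i. interior (L i) \<noteq> {}"
proof -
  have "completely_metrizable_space (euclidean :: 'y topology)"
    using assms(1) Met_TC.completely_metrizable_space_mtopology
    by (simp add: mcomplete_iff_complete)
  moreover have "a \<in> interior (\<Union>i. L i)"
    using assms(3,4) by (meson centre_in_ball interior_maximal open_ball subsetD)
  moreover have "closedin euclidean (L i)" for i
    using assms(2) by (simp add: compact_imp_closed)
  ultimately show ?thesis
    using Baire_category_alt[of "euclidean :: 'y topology" "range L"] by auto
qed

lemma locally_compact_space_translation:
  fixes L :: "'y::{metric_space, topological_ab_group_add} set"
  assumes "compact L" "b \<in> interior L"
  shows "locally_compact_space (euclidean :: 'y topology)"
proof -
  have "\<exists>U K. open U \<and> compact K \<and> y \<in> U \<and> U \<subseteq> K" for y :: 'y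
  proof (intro exI conjI)
    let ?t = "\<lambda>u. u - y + b" and ?s = "\<lambda>u. u + y - b"
    show "open (?t -` interior L)"
      by (intro open_vimage continuous_intros) auto
    show "compact (?s ` L)"
      by (intro compact_continuous_image continuous_intros assms)
    show "y \<in> ?t -` interior L"
      using assms by simp
    show "?t -` interior L \<subseteq> ?s ` L"
    proof
      fix u assume "u \<in> ?t -` interior L"
      then have "?t u \<in> L" "u = ?s (?t u)"
        using interior_subset by auto
      then show "u \<in> ?s ` L" by blast
    qed
  qed
  then show ?thesis
    by (auto simp: locally_compact_space_def)
qed

section \<open>Finite-dimensional and locally compact vector spaces\<close>

text \<open>
  Adding a generator \<open>a\<close> replaces each compact piece \<open>L i\<close> by the sums \<open>m + t a\<close> with
  \<open>m \<in> L i\<close> and \<open>t\<close> in a ball of integer radius, a continuous image of a compact product.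
\<close>

lemma span_of_finite_set_sigma_compact:
  fixes scl :: "'k::{real_normed_field, heine_borel} \<Rightarrow> 'y \<Rightarrow> 'y::{t2_space, topological_ab_group_add}"
  assumes vs: "vector_space scl" and cont: "continuous_on UNIV (\<lambda>(a, y). scl a y)"
    and "finite B"
  shows "\<exists>L :: nat \<Rightarrow> 'y set. (\<forall>i. compact (L i)) \<and> module.span scl B = (\<Union>i. L i)"
  using \<open>finite B\<close>
proof induction
  case empty
  interpret vector_space scl by (rule vs)
  show ?case
    by (intro exI[of _ "\<lambda>_. {0}"]) (simp add: span_empty)
next
  case (insert a B)
  interpret vector_space scl by (rule vs)
  obtain L :: "nat \<Rightarrow> 'y set" where L: "\<And>i. compact (L i)" "span B = (\<Union>i. L i)"
    using insert.IH by blast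
  define M where "M n i = (\<lambda>(t, m). m + scl t a) ` (cball 0 (real n) \<times> L i)" for n i
  have "compact (M n i)" for n i
    unfolding M_def
  proof (intro compact_continuous_image compact_Times L(1) compact_cball)
    have "continuous_on S (\<lambda>p. scl (fst p) a)" for S :: "('k \<times> 'y) set"
      using continuous_on_compose2[OF cont, of S "\<lambda>p. (fst p, a)"]
      by (simp add: continuous_on_Pair continuous_on_fst)
    then show "continuous_on (cball 0 (real n) \<times> L i) (\<lambda>(t, m). m + scl t a)"
      by (simp add: case_prod_unfold continuous_on_add continuous_on_snd)
  qed
  moreover have "span (insert a B) = (\<Union>n i. M n i)"
  proof (intro equalityI subsetI)
    fix y assume "y \<in> span (insert a B)"
    then obtain t where "y - scl t a \<in> span B"
      by (auto simp: span_breakdown_eq)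
    then obtain i where "y - scl t a \<in> L i"
      using L(2) by blast
    moreover obtain n where "norm t \<le> real n"
      using real_arch_simple by blast
    ultimately show "y \<in> (\<Union>n i. M n i)"
      unfolding M_def by (force intro!: image_eqI[of _ _ "(t, y - scl t a)"])
  next
    fix y assume "y \<in> (\<Union>n i. M n i)"
    then obtain i m t where "m \<in> L i" "y = m + scl t a"
      by (auto simp: M_def)
    then show "y \<in> span (insert a B)"
      using L(2) by (auto simp: span_breakdown_eq intro!: exI[of _ t])
  qed
  moreover have "(\<Union>n i. M n i) = (\<Union>j. case prod_decode j of (n, i) \<Rightarrow> M n i)"
  proof -
    have "(\<Union>n i. M n i) = (\<Union>(n, i)\<in>range prod_decode. M n i)"
      by (auto simp: surj_prod_decode)
    then show ?thesis
      by (simp add: image_image)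
  qed
  ultimately show ?case
    by (intro exI[of _ "\<lambda>j. case prod_decode j of (n, i) \<Rightarrow> M n i"]) (auto split: prod.split)
qed

lemma finite_dimensional_if_finite_span:
  fixes scl :: "'k::field \<Rightarrow> 'y \<Rightarrow> 'y::ab_group_add"
  assumes vs: "vector_space scl" and "finite D" "module.span scl D = UNIV"
  shows "finite_dimensional scl"
proof -
  interpret vector_space scl by (rule vs)
  obtain B where B: "B \<subseteq> D" "independent B" "D \<subseteq> span B"
    using maximal_independent_subset .
  then have "span B = UNIV"
    using assms(3) span_minimal[OF B(3) subspace_span] by auto
  then have "finite_dimensional_vector_space scl B"
    using B assms(2) by unfold_locales (auto intro: finite_subset)
  then show ?thesis
    by (auto simp: finite_dimensional_def)
qed

context
  assumes scaleR_continuous: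
    "continuous_on UNIV (\<lambda>(t :: real, y :: 'y::{real_vector, metric_space, topological_ab_group_add}). t *\<^sub>R y)"
begin

lemma tendsto_scaleR_tvs:
  fixes y :: "nat \<Rightarrow> 'y"
  assumes "t \<longlonglongrightarrow> s" "y \<longlonglongrightarrow> z"
  shows "(\<lambda>n. t n *\<^sub>R y n) \<longlonglongrightarrow> s *\<^sub>R z"
  using continuous_on_tendsto_compose[OF scaleR_continuous tendsto_Pair[OF assms]] by simp

lemma continuous_on_scaleR_tvs:
  fixes g :: "'a::topological_space \<Rightarrow> 'y"
  assumes "continuous_on S f" "continuous_on S g"
  shows "continuous_on S (\<lambda>u. f u *\<^sub>R g u)"
  using continuous_on_compose2[OF scaleR_continuous continuous_on_Pair[OF assms]] by simp

text \<open>
  The coordinate \<open>t n\<close> of a convergent sequence along a new generator \<open>a\<close> might be unbounded.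
  Dividing by \<open>1 + \<bar>t n\<bar>\<close> keeps everything bounded: a limit of the normalised sequence either shows
  that the coordinates converge along a subsequence or puts \<open>a\<close> into the smaller span.
\<close>

lemma closed_span_finite:
  fixes B :: "'y set"
  assumes "finite B"
  shows "closed (span B)"
  using assms
proof induction
  case empty
  show ?case by simp
next
  case (insert a B)
  show ?case
  proof (cases "a \<in> span B")
    case True
    then show ?thesis
      using insert.IH by (simp add: span_redundant)
  next
    case False
    show ?thesis
      unfolding closed_sequential_limits
    proof (intro allI impI)
      fix y z assume yz: "(\<forall>n. y n \<in> span (insert a B)) \<and> y \<longlonglongrightarrow> z"
      then obtain t where t: "\<And>n. y n - t n *\<^sub>R a \<in> span B"
        by (auto simp: span_breakdown_eq choice_iff)
      \<comment> \<open>The two scalars \<open>s n\<close> and \<open>s n * t n\<close> satisfy \<open>s n + \<bar>s n * t n\<bar> = 1\<close>, so they cannot both tend to \<open>0\<close>.\<close>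
      define s where "s n = 1 / (1 + \<bar>t n\<bar>)" for n
      have "(s n, s n * t n) \<in> {0..1} \<times> {-1..1}" for n
        by (auto simp: s_def field_simps abs_if)
      moreover have "compact ({0..1} \<times> {-1..1} :: (real \<times> real) set)"
        by (intro compact_Times compact_Icc)
      ultimately obtain p r where r: "strict_mono r" "((\<lambda>n. (s n, s n * t n)) \<circ> r) \<longlonglongrightarrow> p"
        using seq_compactE[OF compact_imp_seq_compact, of _ "\<lambda>n. (s n, s n * t n)"] by metis
      obtain s' u where p: "p = (s', u)" by fastforce
      have s': "(\<lambda>n. s (r n)) \<longlonglongrightarrow> s'" and u: "(\<lambda>n. s (r n) * t (r n)) \<longlonglongrightarrow> u"
        using tendsto_fst[OF r(2)] tendsto_snd[OF r(2)] by (simp_all add: p o_def)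
      have "s n + \<bar>s n * t n\<bar> = 1" for n
        by (simp add: s_def abs_mult field_simps)
      then have sum: "s' + \<bar>u\<bar> = 1"
        using LIMSEQ_unique[OF tendsto_add[OF s' tendsto_rabs[OF u]]] by simp
      have "(\<lambda>n. y (r n)) \<longlonglongrightarrow> z"
        using yz LIMSEQ_subseq_LIMSEQ[OF _ r(1)] by (auto simp: o_def)
      then have 1: "(\<lambda>n. s (r n) *\<^sub>R y (r n) - (s (r n) * t (r n)) *\<^sub>R a) \<longlonglongrightarrow> s' *\<^sub>R z - u *\<^sub>R a"
        by (intro tendsto_diff tendsto_scaleR_tvs s' u tendsto_const)
      have 2: "s (r n) *\<^sub>R y (r n) - (s (r n) * t (r n)) *\<^sub>R a \<in> span B" for n
        using span_scale[OF t[of "r n"], of "s (r n)"] by (simp add: algebra_simps)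
      have lim: "s' *\<^sub>R z - u *\<^sub>R a \<in> span B"
        by (rule closed_sequentially[OF insert.IH 2 1])
      show "z \<in> span (insert a B)"
      proof (cases "s' = 0")
        case True
        then have "u \<noteq> 0" "u *\<^sub>R a \<in> span B"
          using sum span_neg[OF lim] by auto
        then show ?thesis
          using False span_scale[of "u *\<^sub>R a" B "1 / u"] by simp
      next
        case False
        then have "z - (u / s') *\<^sub>R a \<in> span B"
          using span_scale[OF lim, of "1 / s'"] by (simp add: scaleR_right_diff_distrib)
        then show ?thesis
          by (auto simp: span_breakdown_eq)
      qed
    qed
  qed
qed

text \<open>
  Compact sets are bounded in the sense of topological vector spaces, stated sequentially.
\<close>

lemma tendsto_scaleR_compact:
  fixes K :: "'y set"
  assumes "compact K" "t \<longlonglongrightarrow> 0" "\<And>n. k n \<in> K"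
  shows "(\<lambda>n. t n *\<^sub>R k n) \<longlonglongrightarrow> 0"
proof (rule ccontr)
  assume "\<not> ?thesis"
  then obtain e where e: "0 < e" "\<And>N. \<exists>n\<ge>N. e \<le> dist (t n *\<^sub>R k n) 0"
    by (auto simp: lim_sequentially not_less)
  then obtain r0 :: "nat \<Rightarrow> nat" where r0: "strict_mono r0" "\<And>n. e \<le> dist (t (r0 n) *\<^sub>R k (r0 n)) 0"
    using infinite_enumerate[of "{n. e \<le> dist (t n *\<^sub>R k n) 0}"]
    by (auto simp: infinite_nat_iff_unbounded_le)
  obtain l r where "l \<in> K" "strict_mono r" "((k \<circ> r0) \<circ> r) \<longlonglongrightarrow> l"
    using assms(1,3) compact_imp_seq_compact seq_compactE[of K "k \<circ> r0"] by (metis o_apply)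
  moreover from this have "(\<lambda>n. t (r0 (r n))) \<longlonglongrightarrow> 0"
    using LIMSEQ_subseq_LIMSEQ[OF assms(2) strict_mono_o[OF r0(1)]] by (simp add: o_def)
  ultimately have "(\<lambda>n. t (r0 (r n)) *\<^sub>R k (r0 (r n))) \<longlonglongrightarrow> 0"
    using tendsto_scaleR_tvs[of "\<lambda>n. t (r0 (r n))" 0 "\<lambda>n. k (r0 (r n))" l] by (simp add: o_def)
  then show False
    using e(1) r0(2) by (auto simp: lim_sequentially not_less)
      (meson le_refl not_less)
qed

text \<open>
  In a compact space the sequence \<open>n v\<close> would be absorbed by the scalars \<open>1 / n\<close>, so that the
  constant sequence \<open>v\<close> would tend to \<open>0\<close>.
\<close>

lemma noncompact_tvs:
  assumes "\<exists>y z :: 'y. y \<noteq> z"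
  shows "\<not> compact (UNIV :: 'y set)"
proof
  assume cpt: "compact (UNIV :: 'y set)"
  obtain v :: 'y where "v \<noteq> 0"
    using assms by metis
  have "(\<lambda>n. (1 / real (Suc n)) *\<^sub>R (real (Suc n) *\<^sub>R v)) \<longlonglongrightarrow> 0"
    using tendsto_scaleR_compact[OF cpt LIMSEQ_inverse_real_of_nat, of "\<lambda>n. real (Suc n) *\<^sub>R v"]
    by (simp add: inverse_eq_divide)
  then have "(\<lambda>n. v) \<longlonglongrightarrow> 0"
    by simp
  then show False
    using \<open>v \<noteq> 0\<close> by (simp add: LIMSEQ_const_iff)
qed

text \<open>
  Riesz's argument.  Finitely many translates of half a neighbourhood \<open>W \<subseteq> K\<close> of \<open>0\<close> cover the
  compact set \<open>K\<close>, and the centres \<open>D\<close> of these translates span \<open>Y\<close>: iterating the covering shows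
  that \<open>K\<close> is within \<open>(1/2)^n K\<close> of the span of \<open>D\<close> for each \<open>n\<close>, these sets shrink to \<open>0\<close>, the span
  is closed, and \<open>K\<close> absorbs every vector.
\<close>

lemma finite_span_if_locally_compact:
  assumes "locally_compact_space (euclidean :: 'y topology)"
  obtains D :: "'y set" where "finite D" "span D = UNIV"
proof -
  obtain W K :: "'y set" where W: "open W" "0 \<in> W" "W \<subseteq> K" and K: "compact K"
    using assms unfolding locally_compact_space_def by (metis UNIV_I compactin_euclidean_iff open_openin topspace_euclidean)
  define N where "N x = (\<lambda>u. 2 *\<^sub>R (u - x)) -` W" for x
  have "open (N x)" for x
    unfolding N_def
    by (intro open_vimage W continuous_on_scaleR_tvs continuous_intros)
  moreover have "K \<subseteq> (\<Union>x\<in>K. N x)"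
    using W(2) by (auto simp: N_def)
  ultimately obtain D where D: "D \<subseteq> K" "finite D" "K \<subseteq> (\<Union>x\<in>D. N x)"
    using compactE_image[OF K] by metis
  have half: "\<exists>x\<in>D. \<exists>u\<in>K. k = x + (1/2) *\<^sub>R u" if k: "k \<in> K" for k
  proof -
    obtain x where x: "x \<in> D" "2 *\<^sub>R (k - x) \<in> K"
      using k D(3) W(3) by (auto simp: N_def)
    moreover have "k = x + (1/2) *\<^sub>R (2 *\<^sub>R (k - x))"
      by simp
    ultimately show ?thesis by blast
  qed
  have approx: "\<exists>m\<in>span D. \<exists>u\<in>K. k = m + ((1/2)^n) *\<^sub>R u" if "k \<in> K" for k and n :: nat
  proof (induction n)
    case 0
    show ?case
      using that by (intro bexI[of _ 0] bexI[of _ k]) (auto simp: span_zero)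
  next
    case (Suc n)
    then obtain m u where mu: "m \<in> span D" "u \<in> K" "k = m + ((1/2)^n) *\<^sub>R u" by blast
    obtain x w where "x \<in> D" "w \<in> K" "u = x + (1/2) *\<^sub>R w"
      using half[OF mu(2)] by blast
    with mu show ?case
      by (intro bexI[of _ "m + ((1/2)^n) *\<^sub>R x"] bexI[of _ w])
        (auto simp: scaleR_add_right span_add span_scale span_base)
  qed
  have K_span: "k \<in> span D" if k: "k \<in> K" for k
  proof -
    obtain m u where mu: "\<And>n. m n \<in> span D" "\<And>n. u n \<in> K" "\<And>n. k = m n + ((1/2)^n) *\<^sub>R u n"
      using approx[OF k] by metis
    have "(\<lambda>n. k - ((1/2)^n) *\<^sub>R u n) \<longlonglongrightarrow> k - 0"
      by (intro tendsto_diff tendsto_const tendsto_scaleR_compact[OF K _ mu(2)] LIMSEQ_realpow_zero) auto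
    moreover have "k - ((1/2)^n) *\<^sub>R u n = m n" for n
      using mu(3)[of n] by (metis add_diff_cancel_right')
    ultimately have "m \<longlonglongrightarrow> k" by simp
    then show ?thesis
      using closed_sequentially[OF closed_span_finite[OF D(2)]] mu(1) by blast
  qed
  have "y \<in> span D" for y
  proof -
    have "(\<lambda>n. (1 / real (Suc n)) *\<^sub>R y) \<longlonglongrightarrow> 0 *\<^sub>R y"
      by (intro tendsto_scaleR_tvs tendsto_const) (use LIMSEQ_inverse_real_of_nat in \<open>simp add: inverse_eq_divide\<close>)
    then have "(\<lambda>n. (1 / real (Suc n)) *\<^sub>R y) \<longlonglongrightarrow> 0" by simp
    then have "\<forall>\<^sub>F n in sequentially. (1 / real (Suc n)) *\<^sub>R y \<in> W"
      using W topological_tendstoD by blast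
    then obtain n where "(1 / real (Suc n)) *\<^sub>R y \<in> W"
      by (auto simp: eventually_sequentially)
    then have "(1 / real (Suc n)) *\<^sub>R y \<in> span D"
      using K_span W(3) by blast
    from span_scale[OF this, of "real (Suc n)"] show ?thesis by simp
  qed
  then show thesis
    using that D(2) by blast
qed

end

section \<open>The Hausdorff distance and the entourages\<close>

lemma Hausdorff_dist_commute: "Hausdorff_dist A B = Hausdorff_dist B A"
  by (simp add: Hausdorff_dist_def max.commute)

lemma Hausdorff_dist_singletons: "Hausdorff_dist {a} {b} = dist a b"
  by (simp add: Hausdorff_dist_def dist_commute)

lemma Hausdorff_dist_lessD:
  assumes "compact A" "B \<noteq> {}" "Hausdorff_dist A B < e" "a \<in> A"
  shows "\<exists>b\<in>B. dist a b < e"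
proof -
  have "compact ((\<lambda>a. infdist a B) ` A)"
    by (intro compact_continuous_image continuous_intros assms(1))
  then have "infdist a B \<le> (SUP a\<in>A. infdist a B)"
    by (intro cSUP_upper assms(4) bounded_imp_bdd_above compact_imp_bounded)
  also have "\<dots> < e"
    using assms(3) by (simp add: Hausdorff_dist_def)
  finally show ?thesis
    using assms(2) by (auto simp: infdist_def cINF_less_iff split: if_splits)
qed

text \<open>
  Neighbourhoods in \<^const>\<open>tau_uc\<close> are handled through this pointwise form, which avoids the triangle
  inequality for the Hausdorff distance itself.
\<close>

lemma uc_entourage_nearD:
  assumes "(F, G) \<in> uc_entourage K e" "x \<in> K"
  shows "a \<in> F x \<Longrightarrow> \<exists>b\<in>G x. dist a b < e" and "b \<in> G x \<Longrightarrow> \<exists>a\<in>F x. dist a b < e"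
proof -
  have *: "compact (F x)" "compact (G x)" "F x \<noteq> {}" "G x \<noteq> {}" "Hausdorff_dist (F x) (G x) < e"
    using assms by (auto simp: uc_entourage_def compact_valued_def)
  show "\<exists>b\<in>G x. dist a b < e" if "a \<in> F x"
    using Hausdorff_dist_lessD * that by blast
  show "\<exists>a\<in>F x. dist a b < e" if "b \<in> G x"
    using Hausdorff_dist_lessD[of "G x" "F x" e b] * that
    by (simp add: Hausdorff_dist_commute dist_commute)
qed

section \<open>Minimal cusco maps with one-point values\<close>

lemma minimal_cusco_compact_valued: "minimal_cusco F \<Longrightarrow> F \<in> compact_valued"
  by (simp add: minimal_cusco_def cusco_def usco_def compact_valued_def)

lemma minimal_cusco_continuous_function:
  fixes f :: "'x::topological_space \<Rightarrow> 'y::{real_vector, t1_space}"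
  assumes "continuous_on UNIV f"
  shows "minimal_cusco (\<lambda>x. {f x})"
proof -
  have "upper_semicontinuous (\<lambda>x. {f x})"
    unfolding upper_semicontinuous_def
  proof (intro allI impI)
    fix x V assume "open V \<and> {f x} \<subseteq> V"
    then show "\<exists>U. open U \<and> x \<in> U \<and> (\<Union>u\<in>U. {f u}) \<subseteq> V"
      using assms by (intro exI[of _ "f -` V"]) (auto intro: open_vimage)
  qed
  then have "cusco (\<lambda>x. {f x})"
    by (simp add: cusco_def usco_def)
  moreover have "set_graph G = set_graph (\<lambda>x. {f x})"
    if "cusco G" "set_graph G \<subseteq> set_graph (\<lambda>x. {f x})" for G :: "'x \<Rightarrow> 'y set"
    using that unfolding cusco_def usco_def set_graph_def by fastforce
  ultimately show ?thesis
    by (auto simp: minimal_cusco_def)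
qed

text \<open>
  Over a discrete domain every selection of \<open>F\<close> is continuous, hence a cusco map below \<open>F\<close>.
  One-point values are written with \<^const>\<open>the_elem\<close>, the form in which evaluation is shown to be
  continuous.
\<close>

lemma minimal_cusco_discrete_domain:
  fixes F :: "'x::topological_space \<Rightarrow> 'y::{real_vector, t1_space} set"
  assumes "\<And>U :: 'x set. open U" and F: "minimal_cusco F"
  shows "F x = {the_elem (F x)}"
proof -
  define f where "f x = (SOME y. y \<in> F x)" for x
  have f: "f x \<in> F x" for x
    using minimal_cusco_compact_valued[OF F] unfolding f_def compact_valued_def some_in_eq by blast
  have "continuous_on UNIV f"
    using assms(1) by (simp add: continuous_on_open_vimage)
  then have "cusco (\<lambda>x. {f x})"
    using minimal_cusco_continuous_function minimal_cusco_def by blast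
  moreover have "set_graph (\<lambda>x. {f x}) \<subseteq> set_graph F"
    using f by (auto simp: set_graph_def)
  ultimately have "set_graph (\<lambda>x. {f x}) = set_graph F"
    using F by (auto simp: minimal_cusco_def)
  then have "F x = {f x}"
    by (auto simp: set_graph_def set_eq_iff)
  then show ?thesis by simp
qed

section \<open>Evaluation, constant maps and compact families of maps\<close>

lemma openin_tau_uc_subset:
  fixes V :: "'y::metric_space set"
  assumes "open V"
  shows "openin tau_uc {F \<in> compact_valued. F x \<subseteq> V}"
  unfolding openin_tau_uc
proof (intro conjI ballI)
  fix F :: "'a \<Rightarrow> 'y set" assume F: "F \<in> {F \<in> compact_valued. F x \<subseteq> V}"
  then have "compact (F x)" by (simp add: compact_valued_def)
  then obtain e where e: "0 < e" "(\<Union>a\<in>F x. ball a e) \<subseteq> V"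
    using F compact_subset_open_imp_ball_epsilon_subset[OF _ assms] by blast
  have "uc_entourage {x} e `` {F} \<subseteq> {F \<in> compact_valued. F x \<subseteq> V}"
  proof
    fix G assume "G \<in> uc_entourage {x} e `` {F}"
    then have G: "(F, G) \<in> uc_entourage {x} e" by blast
    then have "G x \<subseteq> V"
      using uc_entourage_nearD(2)[OF G] e(2) by fastforce
    then show "G \<in> {F \<in> compact_valued. F x \<subseteq> V}"
      using G by (auto simp: uc_entourage_def)
  qed
  then show "\<exists>K e. compact K \<and> 0 < e \<and> uc_entourage K e `` {F} \<subseteq> {F \<in> compact_valued. F x \<subseteq> V}"
    using e(1) by (intro exI[of _ "{x}"] exI[of _ e]) auto
qed auto

text \<open>
  The restriction to a family \<open>\<F>\<close> covers both applications: the constant maps over any domain,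
  and all minimal cusco maps over a discrete one.
\<close>

lemma continuous_map_evaluation:
  fixes \<F> :: "('x::topological_space \<Rightarrow> 'y::{real_vector, metric_space} set) set"
  assumes "\<And>F. \<lbrakk>minimal_cusco F; F \<in> \<F>\<rbrakk> \<Longrightarrow> F x = {the_elem (F x)}"
  shows "continuous_map (subtopology MC_space \<F>) euclidean (\<lambda>F. the_elem (F x))"
  unfolding continuous_map_def
proof (intro conjI allI impI)
  fix V :: "'y set" assume "openin euclidean V"
  then have "openin tau_uc {F \<in> compact_valued. F x \<subseteq> V}"
    by (simp add: openin_tau_uc_subset)
  moreover have "{F \<in> topspace (subtopology MC_space \<F>). the_elem (F x) \<in> V}
      = {F \<in> compact_valued. F x \<subseteq> V} \<inter> ({F. minimal_cusco F} \<inter> \<F>)"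
  proof -
    have "the_elem (F x) \<in> V \<longleftrightarrow> F \<in> compact_valued \<and> F x \<subseteq> V" if "minimal_cusco F" "F \<in> \<F>" for F
      using minimal_cusco_compact_valued[OF that(1)] by (subst (2) assms[OF that]) simp
    then show ?thesis
      by (auto simp: topspace_MC_space)
  qed
  ultimately show "openin (subtopology MC_space \<F>) {F \<in> topspace (subtopology MC_space \<F>). the_elem (F x) \<in> V}"
    by (auto simp: MC_space_def subtopology_subtopology openin_subtopology)
qed auto

text \<open>
  The values of a map other than these contain two distinct points; maps close to it at the
  corresponding two arguments still have two distinct points.
\<close>

lemma closedin_constant_maps:
  "closedin (MC_space :: ('x::topological_space \<Rightarrow> 'y::{real_vector, metric_space} set) topology)
     {\<lambda>x. {y} |y. True}"
proof -
  let ?N = "{F \<in> compact_valued. \<exists>x z. \<exists>a\<in>F x. \<exists>b\<in>F z. a \<noteq> b} :: ('x \<Rightarrow> 'y set) set"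
  have "openin tau_uc ?N"
    unfolding openin_tau_uc
  proof (intro conjI ballI)
    fix F :: "'x \<Rightarrow> 'y set" assume "F \<in> ?N"
    then obtain x z a b where ab: "a \<in> F x" "b \<in> F z" "a \<noteq> b" by blast
    define e where "e = dist a b / 2"
    have "uc_entourage {x, z} e `` {F} \<subseteq> ?N"
    proof
      fix G assume "G \<in> uc_entourage {x, z} e `` {F}"
      then have G: "(F, G) \<in> uc_entourage {x, z} e" by blast
      obtain a' b' where "a' \<in> G x" "b' \<in> G z" "dist a a' < e" "dist b b' < e"
        using uc_entourage_nearD(1)[OF G] ab by (metis insertCI)
      moreover from this have "a' \<noteq> b'"
        unfolding e_def using dist_triangle_half_r[of a' a "dist a b" b]
        by (metis dist_commute less_irrefl)
      ultimately show "G \<in> ?N"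
        using G by (auto simp: uc_entourage_def)
    qed
    then show "\<exists>K e. compact K \<and> 0 < e \<and> uc_entourage K e `` {F} \<subseteq> ?N"
      using ab(3) by (intro exI[of _ "{x, z}"] exI[of _ e]) (auto simp: e_def)
  qed auto
  moreover have "topspace MC_space - {\<lambda>x. {y} |y. True} = ?N \<inter> {F. minimal_cusco F}"
  proof (intro equalityI subsetI)
    fix F :: "'x \<Rightarrow> 'y set" assume F: "F \<in> topspace MC_space - {\<lambda>x. {y} |y. True}"
    then have mc: "minimal_cusco F" by (simp add: topspace_MC_space)
    note cv = minimal_cusco_compact_valued[OF mc]
    have "\<exists>x z. \<exists>a\<in>F x. \<exists>b\<in>F z. a \<noteq> b"
    proof (rule ccontr)
      assume *: "\<not> ?thesis"
      obtain a where a: "a \<in> F undefined"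
        using cv by (auto simp: compact_valued_def)
      have "F x = {a}" for x
      proof -
        have "F x \<noteq> {}"
          using cv by (auto simp: compact_valued_def)
        moreover have "b = a" if "b \<in> F x" for b
          using * a that by blast
        ultimately show ?thesis by blast
      qed
      then have "F = (\<lambda>x. {a})" ..
      then show False using F by blast
    qed
    with mc cv show "F \<in> ?N \<inter> {F. minimal_cusco F}" by blast
  qed (auto simp: topspace_MC_space)
  moreover have "{\<lambda>x. {y} |y. True} \<subseteq> (topspace MC_space :: ('x \<Rightarrow> 'y set) set)"
    by (auto simp: topspace_MC_space intro: minimal_cusco_continuous_function)
  ultimately show ?thesis
    unfolding closedin_def by (auto simp: MC_space_def openin_subtopology)
qed

text \<open>
  A function in \<open>\<K>\<close> lies in one of finitely many uniformly small open sets \<open>\<O> F\<close>.  Two functions in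
  the same set are uniformly close on \<open>C\<close>, so the rate of convergence of a single one of them serves
  for all; a threshold common to the finitely many sets is the sum of theirs.  The centres \<open>F\<close> may have
  large values, which is why two functions are compared through a common point of \<open>F (x n)\<close>.
\<close>

lemma sequences_tend_uniformly_on_compact_family:
  fixes \<K> :: "('x::topological_space \<Rightarrow> 'y::{real_vector, metric_space} set) set"
  assumes \<K>: "compactin MC_space \<K>" and C: "compact C" "\<And>n. x n \<in> C" and "0 < e"
  shows "\<exists>N. \<forall>n\<ge>N. \<forall>f. (\<lambda>u. {f u}) \<in> \<K> \<and> (\<lambda>n. f (x n)) \<longlonglongrightarrow> l \<longrightarrow> dist (f (x n)) l < e"
proof -
  \<comment> \<open>The strict bound \<open>r\<close>, uniform over \<open>C\<close>, leaves the room that makes \<open>\<O> F\<close> open.\<close>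
  define \<O> where "\<O> F = {G \<in> compact_valued.
      \<exists>r < e / 3. \<forall>u\<in>C. \<forall>a\<in>F u. \<exists>b\<in>G u. dist a b < r}" for F :: "'x \<Rightarrow> 'y set"
  have open_\<O>: "openin tau_uc (\<O> F)" for F
    unfolding openin_tau_uc
  proof (intro conjI ballI)
    fix G assume "G \<in> \<O> F"
    then obtain r where r: "r < e / 3" "\<And>u a. u \<in> C \<Longrightarrow> a \<in> F u \<Longrightarrow> \<exists>b\<in>G u. dist a b < r"
      by (auto simp: \<O>_def)
    define s where "s = (e / 3 - r) / 2"
    have "uc_entourage C s `` {G} \<subseteq> \<O> F"
    proof
      fix H assume "H \<in> uc_entourage C s `` {G}"
      then have H: "(G, H) \<in> uc_entourage C s" by blast
      have "\<exists>c\<in>H u. dist a c < r + s" if u: "u \<in> C" and a: "a \<in> F u" for u a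
      proof -
        obtain b where b: "b \<in> G u" "dist a b < r"
          using r(2)[OF u a] by blast
        obtain c where "c \<in> H u" "dist b c < s"
          using uc_entourage_nearD(1)[OF H u b(1)] by blast
        with b(2) show ?thesis
          using dist_triangle[of a c b] by (intro bexI[of _ c]) auto
      qed
      moreover have "r + s < e / 3"
        using r(1) by (simp add: s_def field_simps)
      ultimately show "H \<in> \<O> F"
        using H unfolding \<O>_def uc_entourage_def by blast
    qed
    then show "\<exists>K d. compact K \<and> 0 < d \<and> uc_entourage K d `` {G} \<subseteq> \<O> F"
      using C(1) r(1) by (intro exI[of _ C] exI[of _ s]) (auto simp: s_def)
  qed (auto simp: \<O>_def)
  have \<K>_tau: "compactin tau_uc \<K>"
    using \<K> by (simp add: MC_space_def compactin_subtopology)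
  then have sub: "\<K> \<subseteq> compact_valued"
    using compactin_subset_topspace topspace_tau_uc by blast
  have "F \<in> \<O> F" if "F \<in> \<K>" for F
  proof -
    have "\<forall>u\<in>C. \<forall>a\<in>F u. \<exists>b\<in>F u. dist a b < e / 6"
      using \<open>0 < e\<close> by (intro ballI bexI) auto
    moreover have "e / 6 < e / 3"
      using \<open>0 < e\<close> by simp
    ultimately show ?thesis
      using that sub unfolding \<O>_def by blast
  qed
  with \<K>_tau obtain \<D> where \<D>: "finite \<D>" "\<D> \<subseteq> \<O> ` \<K>" "\<K> \<subseteq> \<Union>\<D>"
    using compactinD[of tau_uc \<K> "\<O> ` \<K>"] open_\<O> by blast
  define S where "S = {f. (\<lambda>u. {f u}) \<in> \<K> \<and> (\<lambda>n. f (x n)) \<longlonglongrightarrow> l}"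
  have "\<exists>N. \<forall>n\<ge>N. \<forall>f\<in>S. (\<lambda>u. {f u}) \<in> D \<longrightarrow> dist (f (x n)) l < e" if D: "D \<in> \<D>" for D
  proof (cases "\<exists>g\<in>S. (\<lambda>u. {g u}) \<in> D")
    case True
    then obtain g where g: "g \<in> S" "(\<lambda>u. {g u}) \<in> D" by blast
    obtain F where F: "F \<in> \<K>" "D = \<O> F"
      using D \<D>(2) by blast
    obtain N where N: "\<And>n. n \<ge> N \<Longrightarrow> dist (g (x n)) l < e / 3"
      using g(1) metric_LIMSEQ_D[of "\<lambda>n. g (x n)" l "e / 3"] \<open>0 < e\<close> by (auto simp: S_def)
    have "dist (f (x n)) l < e" if "n \<ge> N" "(\<lambda>u. {f u}) \<in> D" for f n
    proof -
      obtain a where a: "a \<in> F (x n)"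
        using F(1) sub by (auto simp: compact_valued_def subset_iff)
      have near: "dist a (h (x n)) < e / 3" if h: "(\<lambda>u. {h u}) \<in> D" for h
      proof -
        obtain r where "r < e / 3" "\<forall>u\<in>C. \<forall>a\<in>F u. dist a (h u) < r"
          using h unfolding F(2) \<O>_def by auto
        then show ?thesis
          using a C(2)[of n] by force
      qed
      have "dist a (f (x n)) < e / 3" "dist a (g (x n)) < e / 3"
        using near that(2) g(2) by blast+
      then show ?thesis
        using N[OF that(1)] dist_triangle[of "f (x n)" l a] dist_triangle[of a l "g (x n)"]
        by (simp add: dist_commute)
    qed
    then show ?thesis by blast
  qed blast
  then obtain N where N: "\<And>D n f. \<lbrakk>D \<in> \<D>; n \<ge> N D; f \<in> S; (\<lambda>u. {f u}) \<in> D\<rbrakk> \<Longrightarrow> dist (f (x n)) l < e"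
    by metis
  show ?thesis
  proof (intro exI[of _ "\<Sum>D\<in>\<D>. N D"] allI impI)
    fix n f assume n: "sum N \<D> \<le> n" and f: "(\<lambda>u. {f u}) \<in> \<K> \<and> (\<lambda>n. f (x n)) \<longlonglongrightarrow> l"
    then obtain D where D: "D \<in> \<D>" "(\<lambda>u. {f u}) \<in> D"
      using \<D>(3) by blast
    moreover have "N D \<le> n"
      using member_le_sum[OF D(1), of N] \<D>(1) n by simp
    ultimately show "dist (f (x n)) l < e"
      using N f by (simp add: S_def)
  qed
qed

section \<open>Sigma-compactness and local compactness\<close>

lemma locally_sigma_compact_at:
  fixes F0 :: "'x::topological_space \<Rightarrow> 'y::{real_vector, metric_space} set"
  assumes "locally_sigma_compact_space (MC_space :: ('x \<Rightarrow> 'y set) topology)" and F0: "minimal_cusco F0"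
  obtains \<K> :: "nat \<Rightarrow> ('x \<Rightarrow> 'y set) set" and C e
  where "compact C" "0 < e" "\<And>i. compactin MC_space (\<K> i)"
    "\<And>F. minimal_cusco F \<Longrightarrow> (\<And>x. x \<in> C \<Longrightarrow> Hausdorff_dist (F0 x) (F x) < e) \<Longrightarrow> F \<in> (\<Union>i. \<K> i)"
proof -
  obtain U N where UN: "openin MC_space U" "F0 \<in> U" "U \<subseteq> N" "N \<subseteq> topspace MC_space"
    "sigma_compact_space (subtopology MC_space N)"
    using assms by (auto simp: locally_sigma_compact_space_def topspace_MC_space)
  then obtain \<L> where \<L>: "countable \<L>" "\<And>L. L \<in> \<L> \<Longrightarrow> compactin (subtopology MC_space N) L" "\<Union>\<L> = N"
    unfolding sigma_compact_space_def by (metis topspace_subtopology_subset)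
  then have ne: "\<L> \<noteq> {}"
    using UN by blast
  obtain \<V> where \<V>: "openin tau_uc \<V>" "U = \<V> \<inter> {F. minimal_cusco F}"
    using UN(1) by (auto simp: MC_space_def openin_subtopology)
  obtain C e where Ce: "compact C" "0 < e" "uc_entourage C e `` {F0} \<subseteq> \<V>"
    using \<V> UN(2) by (auto simp: openin_tau_uc)
  show thesis
  proof (rule that[OF Ce(1,2)])
    show "compactin MC_space (from_nat_into \<L> i)" for i
      using \<L>(2) from_nat_into[OF ne] by (auto simp: compactin_subtopology)
    show "F \<in> (\<Union>i. from_nat_into \<L> i)"
      if "minimal_cusco F" "\<And>x. x \<in> C \<Longrightarrow> Hausdorff_dist (F0 x) (F x) < e" for F
    proof -
      have "F \<in> uc_entourage C e `` {F0}"
        using that F0 minimal_cusco_compact_valued by (auto simp: uc_entourage_def)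
      with Ce(3) have "F \<in> \<V>" ..
      then have "F \<in> \<Union>\<L>"
        using \<V>(2) UN(3) \<L>(3) that(1) by (simp add: subset_iff)
      then show ?thesis
        by (simp add: range_from_nat_into[OF ne \<L>(1)])
    qed
  qed
qed

lemma locally_compact_imp_locally_sigma_compact_space:
  assumes "locally_compact_space T"
  shows "locally_sigma_compact_space T"
  unfolding locally_sigma_compact_space_def
proof
  fix x assume "x \<in> topspace T"
  then obtain U K where UK: "openin T U" "compactin T K" "x \<in> U" "U \<subseteq> K"
    using assms by (auto simp: locally_compact_space_def)
  moreover have "sigma_compact_space (subtopology T K)"
    unfolding sigma_compact_space_def using UK(2) compactin_subset_topspace[OF UK(2)]
    by (intro exI[of _ "{K}"]) (auto simp: compactin_subtopology)
  ultimately show "\<exists>U N. openin T U \<and> x \<in> U \<and> U \<subseteq> N \<and> N \<subseteq> topspace T \<and> sigma_compact_space (subtopology T N)"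
    using compactin_subset_topspace by blast
qed

lemma sigma_compact_imp_locally_sigma_compact_space:
  "sigma_compact_space T \<Longrightarrow> locally_sigma_compact_space T"
  unfolding locally_sigma_compact_space_def
  by (intro ballI exI[of _ "topspace T"]) (simp add: subtopology_topspace)

lemma sigma_compact_space_continuous_image:
  assumes "sigma_compact_space S" "continuous_map S T f" "f ` topspace S = topspace T"
  shows "sigma_compact_space T"
proof -
  obtain \<K> where \<K>: "countable \<K>" "\<And>K. K \<in> \<K> \<Longrightarrow> compactin S K" "\<Union>\<K> = topspace S"
    using assms(1) by (auto simp: sigma_compact_space_def)
  have "compactin T (f ` K)" if "K \<in> \<K>" for K
    using image_compactin[OF \<K>(2)[OF that] assms(2)] .
  moreover have "\<Union>((`) f ` \<K>) = topspace T"
    using assms(3) by (simp add: image_Union flip: \<K>(3))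
  ultimately show ?thesis
    unfolding sigma_compact_space_def using \<K>(1) by (intro exI[of _ "(`) f ` \<K>"]) simp
qed

section \<open>Functions outside countably many compact families\<close>

text \<open>
  Every neighbourhood \<open>V\<close> of \<open>p\<close> contains a point other than \<open>p\<close>; separating the two splits off an
  open set from \<open>V\<close> and leaves a smaller neighbourhood of \<open>p\<close> in which to continue.
\<close>

lemma disjoint_open_sets_near_accumulation_point:
  fixes p :: "'x::t2_space"
  assumes "\<not> open {p}" "open U" "p \<in> U"
  shows "\<exists>(W :: nat \<Rightarrow> 'x set) x. (\<forall>n. open (W n) \<and> W n \<subseteq> U \<and> x n \<in> W n) \<and> (\<forall>m n. m \<noteq> n \<longrightarrow> W m \<inter> W n = {})"
proof -
  let ?nbhd = "\<lambda>V. open V \<and> p \<in> V \<and> V \<subseteq> U"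
  let ?split = "\<lambda>V V'. V' \<subseteq> V \<and> (\<exists>W x. open W \<and> x \<in> W \<and> W \<subseteq> V \<and> W \<inter> V' = {})"
  have step: "\<exists>V'. ?nbhd V' \<and> ?split V V'" if V: "?nbhd V" for V
  proof -
    have "V \<noteq> {p}"
      using V assms(1) by auto
    then obtain x where x: "x \<in> V" "x \<noteq> p"
      using V by blast
    obtain A B where "open A" "open B" "x \<in> A" "p \<in> B" "A \<inter> B = {}"
      using hausdorff[OF x(2)] by blast
    then show ?thesis
      using V x by (intro exI[of _ "V \<inter> B"] conjI exI[of _ "V \<inter> A"] exI[of _ x]) auto
  qed
  have "\<exists>V. \<forall>n :: nat. ?nbhd (V n) \<and> ?split (V n) (V (Suc n))"
  proof (rule dependent_nat_choice[of "\<lambda>_. ?nbhd" "\<lambda>_. ?split"])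
    show "\<exists>V. ?nbhd V"
      using assms(2,3) by blast
  qed (rule step)
  then obtain V where "\<forall>n :: nat. ?nbhd (V n) \<and> ?split (V n) (V (Suc n))" ..
  then have V: "\<forall>n. ?nbhd (V n)" and V_Suc: "\<forall>n. ?split (V n) (V (Suc n))"
    by simp_all
  from V_Suc obtain W x where W: "\<And>n. open (W n) \<and> x n \<in> W n \<and> W n \<subseteq> V n \<and> W n \<inter> V (Suc n) = {}"
    by metis
  have "antimono V"
    using V_Suc by (simp add: antimono_iff_le_Suc)
  then have "W m \<inter> W n = {}" if "m < n" for m n
    using W[of m] W[of n] antimonoD[OF \<open>antimono V\<close> Suc_leI[OF that]] by blast
  then have "W m \<inter> W n = {}" if "m \<noteq> n" for m n
    using that by (metis Int_commute linorder_neqE_nat)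
  moreover have "W n \<subseteq> U" for n
    using V W[of n] by blast
  ultimately show ?thesis
    using W by (intro exI[of _ W] exI[of _ x]) auto
qed

lemma bump_functions_near_accumulation_point:
  fixes p :: "'x::t2_space"
  assumes lc: "locally_compact_space (euclidean :: 'x topology)" and p: "\<not> open {p}"
  shows "\<exists>C (x :: nat \<Rightarrow> 'x) (g :: nat \<Rightarrow> 'x \<Rightarrow> real). compact C \<and> (\<forall>n. x n \<in> C) \<and>
    (\<forall>n. continuous_on UNIV (g n) \<and> (\<forall>u. g n u \<in> {0..1})) \<and>
    (\<forall>m n. g m (x n) = (if m = n then 1 else 0))"
proof -
  obtain U C where U: "open U" "compact C" "p \<in> U" "U \<subseteq> C"
    using lc unfolding locally_compact_space_def
    by (metis UNIV_I compactin_euclidean_iff open_openin topspace_euclidean)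
  obtain W :: "nat \<Rightarrow> 'x set" and x where W: "\<forall>n. open (W n) \<and> W n \<subseteq> U \<and> x n \<in> W n"
    "\<forall>m n. m \<noteq> n \<longrightarrow> W m \<inter> W n = {}"
    using disjoint_open_sets_near_accumulation_point[OF p U(1,3)] by blast
  have "Hausdorff_space (euclidean :: 'x topology)"
    unfolding Hausdorff_space_def disjnt_def by (metis hausdorff open_openin)
  with lc have "completely_regular_space (euclidean :: 'x topology)"
    by (intro locally_compact_regular_imp_completely_regular_space) auto
  then have "\<exists>f. continuous_map euclidean (top_of_set {0..1 :: real}) f \<and> f (x n) = 0 \<and> f ` (- W n) \<subseteq> {1}" for n
    using W(1) unfolding completely_regular_space_def
    by (simp add: closed_Compl)
  then obtain f where f: "\<And>n. continuous_map euclidean (top_of_set {0..1 :: real}) (f n)"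
    "\<And>n. f n (x n) = 0" "\<And>n. f n ` (- W n) \<subseteq> {1}"
    by metis
  have cont: "continuous_on UNIV (f n)" and range: "f n u \<in> {0..1}" for n u
    using f(1)[of n] by (auto simp: continuous_map_in_subtopology)
  show ?thesis
  proof (intro exI[of _ C] exI[of _ x] exI[of _ "\<lambda>n u. 1 - f n u"] conjI allI)
    show "x n \<in> C" for n
      using W(1) U(4) by blast
    show "1 - f m (x n) = (if m = n then 1 else 0)" for m n
    proof (cases "m = n")
      case False
      then have "x n \<in> - W m"
        using W by blast
      then show ?thesis
        using False f(3)[of m] by auto
    qed (simp add: f(2))
    show "1 - f n u \<in> {0..1}" for n u
      using range[of n u] by simp
  qed (use cont U(2) in \<open>auto intro: continuous_intros\<close>)
qed

text \<open>
  The function is \<open>s u *\<^sub>R v\<close>, where \<open>s\<close> takes the value \<open>c i\<close> at the point \<open>x (r i)\<close> and vanishes at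
  all other points \<open>x m\<close>.  The index \<open>r i\<close> is so late that every function in \<open>\<K> i\<close> tending to \<open>0\<close> along
  \<open>x\<close> is by then closer to \<open>0\<close> than \<open>c i *\<^sub>R v\<close>.
\<close>

lemma function_outside_compact_families_accumulation_point:
  fixes p :: "'x::t2_space" and \<K> :: "nat \<Rightarrow> ('x \<Rightarrow> 'y::{real_vector, metric_space, topological_ab_group_add} set) set"
  assumes scaleR: "continuous_on UNIV (\<lambda>(t :: real, y :: 'y). t *\<^sub>R y)"
    and lc: "locally_compact_space (euclidean :: 'x topology)" and p: "\<not> open {p}"
    and v: "v \<noteq> (0 :: 'y)" and "0 < e" and \<K>: "\<And>i. compactin MC_space (\<K> i)"
  shows "\<exists>h :: 'x \<Rightarrow> 'y. continuous_on UNIV h \<and> (\<forall>u. dist 0 (h u) < e) \<and> (\<lambda>u. {h u}) \<notin> (\<Union>i. \<K> i)"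
proof -
  obtain C :: "'x set" and x :: "nat \<Rightarrow> 'x" and g :: "nat \<Rightarrow> 'x \<Rightarrow> real"
    where *: "compact C \<and> (\<forall>n. x n \<in> C) \<and> (\<forall>n. continuous_on UNIV (g n) \<and> (\<forall>u. g n u \<in> {0..1})) \<and>
      (\<forall>m n. g m (x n) = (if m = n then 1 else 0))"
    using bump_functions_near_accumulation_point[OF lc p] by (elim exE) (rule that)
  then have C: "compact C" "\<And>n. x n \<in> C"
    and g: "\<And>n. continuous_on UNIV (g n)" "\<And>n u. g n u \<in> {0..1}"
      "\<And>m n. g m (x n) = (if m = n then 1 else 0)"
    by simp_all
  have g_bounds: "0 \<le> g n u" "g n u \<le> 1" for n u
    using g(2)[of n u] by simp_all
  have scaleR_v: "continuous_on S (\<lambda>t. t *\<^sub>R v)" for S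
    by (rule continuous_on_scaleR_tvs[OF scaleR]) (intro continuous_intros)+
  then have "((\<lambda>t. t *\<^sub>R v) \<longlongrightarrow> 0 *\<^sub>R v) (at 0)"
    by (metis continuous_on_def UNIV_I)
  then obtain \<delta> where \<delta>: "0 < \<delta>" "\<And>t. t \<noteq> 0 \<Longrightarrow> \<bar>t\<bar> < \<delta> \<Longrightarrow> dist (t *\<^sub>R v) 0 < e"
    using \<open>0 < e\<close> unfolding tendsto_iff eventually_at by (auto simp: dist_norm)
  \<comment> \<open>The sum \<open>\<delta> / 2\<close> of the coefficients stays below \<open>\<delta>\<close>, which keeps the function in the neighbourhood.\<close>
  define c where "c i = (\<delta> / 2) * (1 / 2) ^ Suc i" for i
  have c_pos: "0 < c i" for i
    using \<delta>(1) by (simp add: c_def)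
  have c_sums: "c sums (\<delta> / 2)"
    using sums_mult[OF power_half_series, of "\<delta> / 2"] by (simp add: c_def[abs_def])
  have "\<exists>N. \<forall>n\<ge>N. \<forall>f. (\<lambda>u. {f u}) \<in> \<K> i \<and> (\<lambda>n. f (x n)) \<longlonglongrightarrow> 0 \<longrightarrow>
      dist (f (x n)) 0 < dist (c i *\<^sub>R v) 0" for i
    using v c_pos[of i]
    by (intro sequences_tend_uniformly_on_compact_family[OF \<K> C]) auto
  then obtain N where N: "\<And>i n f. \<lbrakk>n \<ge> N i; (\<lambda>u. {f u}) \<in> \<K> i; (\<lambda>n. f (x n)) \<longlonglongrightarrow> 0\<rbrakk>
      \<Longrightarrow> dist (f (x n)) 0 < dist (c i *\<^sub>R v) 0"
    by metis
  \<comment> \<open>Strictly increasing, and beyond each threshold: \<open>N i\<close> is one of the summands.\<close>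
  define r where "r i = i + (\<Sum>j\<le>i. N j)" for i
  have r: "strict_mono r" "N i \<le> r i" for i
    by (auto simp: r_def strict_mono_Suc_iff intro!: trans_le_add2 member_le_sum)
  define s where "s u = (\<Sum>i. c i * g (r i) u)" for u
  have bound: "norm (c i * g (r i) u) \<le> c i" for i u
    using c_pos[of i] g_bounds[of "r i" u] by (simp add: abs_mult mult_left_le)
  have "uniform_limit UNIV (\<lambda>n u. \<Sum>i<n. c i * g (r i) u) s sequentially"
    unfolding s_def by (intro Weierstrass_m_test[OF bound sums_summable[OF c_sums]])
  then have s_cont: "continuous_on UNIV s"
    by (rule uniform_limit_theorem[rotated])
      (auto intro!: always_eventually continuous_intros continuous_on_compose2[OF g(1)])
  have s_bound: "0 \<le> s u" "s u < \<delta>" for u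
  proof -
    have summable: "summable (\<lambda>i. c i * g (r i) u)"
      using summable_comparison_test'[OF sums_summable[OF c_sums] bound] .
    then show "0 \<le> s u"
      unfolding s_def using c_pos g_bounds by (intro suminf_nonneg) (auto intro: mult_nonneg_nonneg less_imp_le)
    have "s u \<le> (\<Sum>i. c i)"
      unfolding s_def using bound[of _ u]
      by (intro suminf_le summable sums_summable[OF c_sums]) (simp add: abs_le_iff)
    also have "\<dots> < \<delta>"
      using sums_unique[OF c_sums] \<delta>(1) by simp
    finally show "s u < \<delta>" .
  qed
  have s_r: "s (x (r i)) = c i" for i
  proof -
    have "c j * g (r j) (x (r i)) = (if j = i then c j else 0)" for j
      using strict_mono_eq[OF r(1)] by (simp add: g(3))
    then show ?thesis
      unfolding s_def using sums_unique[OF sums_single[of i c]] by simp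
  qed
  have s_other: "s (x m) = 0" if "m \<notin> range r" for m
  proof -
    have "g (r j) (x m) = 0" for j
      using that by (auto simp: g(3))
    then show ?thesis by (simp add: s_def)
  qed
  have "c \<longlonglongrightarrow> 0"
    using summable_LIMSEQ_zero[OF sums_summable[OF c_sums]] .
  have s_lim: "(\<lambda>m. s (x m)) \<longlonglongrightarrow> 0"
  proof (rule metric_LIMSEQ_I)
    fix d :: real assume "0 < d"
    then obtain I where I: "\<And>i. i \<ge> I \<Longrightarrow> dist (c i) 0 < d"
      using metric_LIMSEQ_D[OF \<open>c \<longlonglongrightarrow> 0\<close>] by blast
    show "\<exists>M. \<forall>m\<ge>M. dist (s (x m)) 0 < d"
    proof (intro exI[of _ "r I"] allI impI)
      fix m assume m: "r I \<le> m"
      show "dist (s (x m)) 0 < d"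
      proof (cases "m \<in> range r")
        case True
        then obtain i where "m = r i" by blast
        then show ?thesis
          using m I[of i] strict_mono_less_eq[OF r(1)] s_r by simp
      qed (simp add: s_other \<open>0 < d\<close>)
    qed
  qed
  show ?thesis
  proof (intro exI[of _ "\<lambda>u. s u *\<^sub>R v"] conjI allI)
    show "continuous_on UNIV (\<lambda>u. s u *\<^sub>R v)"
      by (rule continuous_on_scaleR_tvs[OF scaleR s_cont]) (intro continuous_intros)
    show "dist 0 (s u *\<^sub>R v) < e" for u
      using \<delta>(2)[of "s u"] s_bound[of u] \<open>0 < e\<close> by (cases "s u = 0") (auto simp: dist_commute)
    show "(\<lambda>u. {s u *\<^sub>R v}) \<notin> (\<Union>i. \<K> i)"
    proof
      assume "(\<lambda>u. {s u *\<^sub>R v}) \<in> (\<Union>i. \<K> i)"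
      then obtain i where i: "(\<lambda>u. {s u *\<^sub>R v}) \<in> \<K> i" by blast
      have "(\<lambda>m. s (x m) *\<^sub>R v) \<longlonglongrightarrow> 0"
        using tendsto_scaleR_tvs[OF scaleR s_lim tendsto_const[of v]] by simp
      from N[OF r(2) i this] show False
        by (simp add: s_r)
    qed
  qed
qed

text \<open>
  Compact subsets of a discrete space are finite, so infinitely many points \<open>x i\<close> are left on which
  the function is unrestricted; its value at \<open>x i\<close> keeps it out of \<open>\<K> i\<close>.
\<close>

lemma function_outside_compact_families_infinite_discrete:
  fixes \<K> :: "nat \<Rightarrow> ('x::topological_space \<Rightarrow> 'y::{real_vector, metric_space} set) set"
  assumes discrete: "\<And>U :: 'x set. open U" and inf: "infinite (UNIV :: 'x set)"
    and noncompact: "\<not> compact (UNIV :: 'y set)"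
    and C: "compact C" and \<K>: "\<And>i. compactin MC_space (\<K> i)"
  shows "\<exists>f :: 'x \<Rightarrow> 'y. (\<forall>u\<in>C. f u = 0) \<and> (\<lambda>u. {f u}) \<notin> (\<Union>i. \<K> i)"
proof -
  obtain D where "D \<subseteq> C" "finite D" "C \<subseteq> (\<Union>u\<in>D. {u})"
    using compactE_image[OF C, of C "\<lambda>u. {u}"] discrete by auto
  then have "finite C"
    by (auto intro: finite_subset)
  then have "infinite (- C)"
    using inf by (metis finite_compl)
  then obtain x :: "nat \<Rightarrow> 'x" where x: "inj x" "range x \<subseteq> - C"
    using infinite_countable_subset by blast
  have "\<exists>y. y \<notin> (\<lambda>F. the_elem (F (x i))) ` \<K> i" for i
  proof -
    have "continuous_map MC_space euclidean (\<lambda>F :: 'x \<Rightarrow> 'y set. the_elem (F (x i)))"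
      using continuous_map_evaluation[of UNIV "x i"] minimal_cusco_discrete_domain[OF discrete]
      by (metis subtopology_UNIV)
    then have "compact ((\<lambda>F. the_elem (F (x i))) ` \<K> i)"
      using image_compactin[OF \<K>] by fastforce
    then show ?thesis
      using noncompact by (metis UNIV_eq_I)
  qed
  then obtain y where y: "\<And>i. y i \<notin> (\<lambda>F. the_elem (F (x i))) ` \<K> i"
    by metis
  define f where "f u = (if u \<in> range x then y (inv x u) else 0)" for u
  show ?thesis
  proof (intro exI[of _ f] conjI ballI)
    show "f u = 0" if "u \<in> C" for u
      using that x(2) by (auto simp: f_def)
    have "f (x i) = y i" for i
      using x(1) by (simp add: f_def)
    then have "(\<lambda>u. {f u}) \<notin> \<K> i" for i
      using y[of i] image_eqI[of "y i" "\<lambda>F. the_elem (F (x i))" "\<lambda>u. {f u}"] by auto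
    then show "(\<lambda>u. {f u}) \<notin> (\<Union>i. \<K> i)"
      by blast
  qed
qed

section \<open>Consequences of local sigma-compactness\<close>

lemma finite_domain_if_locally_sigma_compact:
  assumes scaleR: "continuous_on UNIV (\<lambda>(t :: real, y :: 'y::{real_vector, metric_space, topological_ab_group_add}). t *\<^sub>R y)"
    and "\<exists>y z :: 'y. y \<noteq> z"
    and lc: "locally_compact_space (euclidean :: 'x::t2_space topology)"
    and ls: "locally_sigma_compact_space (MC_space :: ('x \<Rightarrow> 'y set) topology)"
  shows "finite (UNIV :: 'x set)"
proof (rule ccontr)
  assume inf: "infinite (UNIV :: 'x set)"
  have zero: "minimal_cusco (\<lambda>u :: 'x. {0 :: 'y})"
    by (intro minimal_cusco_continuous_function continuous_intros)
  obtain \<K> :: "nat \<Rightarrow> ('x \<Rightarrow> 'y set) set" and C e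
    where C: "compact C" "0 < e" and \<K>: "\<And>i. compactin MC_space (\<K> i)"
      and cover: "\<And>F. minimal_cusco F \<Longrightarrow> (\<And>x. x \<in> C \<Longrightarrow> Hausdorff_dist {0} (F x) < e) \<Longrightarrow> F \<in> (\<Union>i. \<K> i)"
    using locally_sigma_compact_at[OF ls zero] by metis
  have "\<exists>h :: 'x \<Rightarrow> 'y. continuous_on UNIV h \<and> (\<forall>u\<in>C. dist 0 (h u) < e) \<and> (\<lambda>u. {h u}) \<notin> (\<Union>i. \<K> i)"
  proof (cases "\<exists>p :: 'x. \<not> open {p}")
    case True
    obtain v :: 'y where "v \<noteq> 0"
      using assms(2) by metis
    obtain p :: 'x where "\<not> open {p}"
      using True by blast
    from function_outside_compact_families_accumulation_point[where \<K> = \<K>, OF scaleR lc this \<open>v \<noteq> 0\<close> C(2) \<K>]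
    show ?thesis by (elim ex_forward) simp
  next
    case False
    then have "open (\<Union>u\<in>U. {u})" for U :: "'x set"
      by (intro open_UN) simp
    then have discrete: "open U" for U :: "'x set"
      by simp
    have "continuous_on UNIV f" for f :: "'x \<Rightarrow> 'y"
      using discrete by (simp add: continuous_on_open_vimage)
    with function_outside_compact_families_infinite_discrete[where \<K> = \<K>, OF discrete inf noncompact_tvs[OF scaleR assms(2)] C(1) \<K>]
    show ?thesis
      using C(2) by (elim ex_forward) simp
  qed
  then obtain h where h: "continuous_on UNIV h" "\<And>u. u \<in> C \<Longrightarrow> dist 0 (h u) < e" "(\<lambda>u. {h u}) \<notin> (\<Union>i. \<K> i)"
    by (elim exE conjE) (rule that; simp)
  have "(\<lambda>u. {h u}) \<in> (\<Union>i. \<K> i)"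
    by (rule cover) (simp_all add: h(1,2) minimal_cusco_continuous_function Hausdorff_dist_singletons)
  with h(3) show False by contradiction
qed

text \<open>
  The constant maps in \<open>\<K> i\<close> form a compact set, because the constant maps are closed; evaluation
  sends it onto a compact subset \<open>L i\<close> of \<open>Y\<close>, and these subsets cover a ball.
\<close>

lemma locally_compact_codomain_if_locally_sigma_compact:
  assumes "complete (UNIV :: 'y::{real_vector, metric_space, topological_ab_group_add} set)"
    and ls: "locally_sigma_compact_space (MC_space :: ('x::topological_space \<Rightarrow> 'y set) topology)"
  shows "locally_compact_space (euclidean :: 'y topology)"
proof -
  let ?const = "\<lambda>y (x :: 'x). {y :: 'y}" and ?\<C> = "{\<lambda>x :: 'x. {y :: 'y} |y. True}"
  have const: "minimal_cusco (?const y)" for y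
    by (intro minimal_cusco_continuous_function continuous_intros)
  obtain \<K> :: "nat \<Rightarrow> ('x \<Rightarrow> 'y set) set" and C e
    where e: "0 < e" and \<K>: "\<And>i. compactin MC_space (\<K> i)"
      and cover: "\<And>F. minimal_cusco F \<Longrightarrow> (\<And>x. x \<in> C \<Longrightarrow> Hausdorff_dist {0} (F x) < e) \<Longrightarrow> F \<in> (\<Union>i. \<K> i)"
    using locally_sigma_compact_at[OF ls const[of 0]] by metis
  define L where "L i = {y. ?const y \<in> \<K> i}" for i
  have "compact (L i)" for i
  proof -
    have "compactin (subtopology MC_space ?\<C>) (?\<C> \<inter> \<K> i)"
      using closed_Int_compactin[OF closedin_constant_maps \<K>] by (auto simp: compactin_subtopology)
    moreover have "continuous_map (subtopology MC_space ?\<C>) euclidean (\<lambda>F. the_elem (F undefined))"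
      by (rule continuous_map_evaluation) auto
    ultimately have "compact ((\<lambda>F. the_elem (F undefined)) ` (?\<C> \<inter> \<K> i))"
      using image_compactin by fastforce
    moreover have "(\<lambda>F. the_elem (F undefined)) ` (?\<C> \<inter> \<K> i) = L i"
      by (force simp: L_def)
    ultimately show ?thesis by simp
  qed
  moreover have "ball 0 e \<subseteq> (\<Union>i. L i)"
    using cover[OF const] by (auto simp: L_def Hausdorff_dist_singletons)
  ultimately obtain i b where "b \<in> interior (L i)"
    using compact_cover_of_ball_has_interior[OF assms(1) _ e, of L 0] by auto
  with \<open>\<And>i. compact (L i)\<close> show ?thesis
    by (rule locally_compact_space_translation)
qed

section \<open>Finite domains\<close>

lemma MC_space_finite_domain_homeomorphic:
  assumes fin: "finite (UNIV :: 'x::t2_space set)"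
  shows "homeomorphic_maps (euclidean :: ('x \<Rightarrow> 'y::{real_vector, metric_space}) topology) MC_space
    (\<lambda>f x. {f x}) (\<lambda>F x. the_elem (F x))"
proof -
  have discrete: "open U" for U :: "'x set"
    using finite_imp_closed[of "- U"] fin by (simp add: closed_def rev_finite_subset)
  note single = minimal_cusco_discrete_domain[OF discrete]
  have mc: "minimal_cusco (\<lambda>x. {f x})" for f :: "'x \<Rightarrow> 'y"
    using discrete by (intro minimal_cusco_continuous_function) (simp add: continuous_on_open_vimage)
  have "continuous_map euclidean MC_space (\<lambda>(f :: 'x \<Rightarrow> 'y) x. {f x})"
    unfolding continuous_map_def
  proof (intro conjI allI impI)
    fix \<U> :: "('x \<Rightarrow> 'y set) set" assume "openin MC_space \<U>"
    then obtain \<V> where \<V>: "openin tau_uc \<V>" "\<U> = \<V> \<inter> {F. minimal_cusco F}"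
      by (auto simp: MC_space_def openin_subtopology)
    have "\<exists>T. open T \<and> f \<in> T \<and> T \<subseteq> {f. (\<lambda>x. {f x}) \<in> \<U>}" if f: "(\<lambda>x. {f x}) \<in> \<U>" for f
    proof -
      obtain K e where Ke: "0 < e" "uc_entourage K e `` {\<lambda>x. {f x}} \<subseteq> \<V>"
        using f \<V> by (auto simp: openin_tau_uc)
      show ?thesis
      proof (intro exI conjI)
        show "open (\<Pi>\<^sub>E x\<in>UNIV. ball (f x) e)"
          by (intro open_PiE open_ball) (rule finite_subset[OF subset_UNIV fin])
        show "f \<in> (\<Pi>\<^sub>E x\<in>UNIV. ball (f x) e)"
          using Ke(1) by (auto simp: PiE_iff)
        show "(\<Pi>\<^sub>E x\<in>UNIV. ball (f x) e) \<subseteq> {f. (\<lambda>x. {f x}) \<in> \<U>}"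
        proof
          fix g assume "g \<in> (\<Pi>\<^sub>E x\<in>UNIV. ball (f x) e)"
          then have "(\<lambda>x. {g x}) \<in> uc_entourage K e `` {\<lambda>x. {f x}}"
            by (auto simp: uc_entourage_def compact_valued_def Hausdorff_dist_singletons PiE_iff)
          then show "g \<in> {f. (\<lambda>x. {f x}) \<in> \<U>}"
            using Ke(2) \<V>(2) mc by blast
        qed
      qed
    qed
    then have "open {f. (\<lambda>x. {f x}) \<in> \<U>}"
      by (subst open_subopen) simp
    then show "openin euclidean {f \<in> topspace euclidean. (\<lambda>x. {f x}) \<in> \<U>}"
      by simp
  qed (simp add: topspace_MC_space mc)
  moreover have "continuous_map MC_space euclidean (\<lambda>F (x :: 'x). the_elem (F x) :: 'y)"
  proof -
    have "continuous_map MC_space euclidean (\<lambda>F. the_elem (F x) :: 'y)" for x :: 'x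
      using continuous_map_evaluation[of UNIV x] single by (metis subtopology_UNIV)
    then show ?thesis
      by (simp add: continuous_map_componentwise_UNIV flip: euclidean_product_topology)
  qed
  ultimately show ?thesis
    using single by (auto simp: homeomorphic_maps_def topspace_MC_space)
qed

text \<open>
  For \<open>\<sigma>\<close>-compactness, a function on a finite domain takes its values in the union of finitely many
  of the countably many compact sets, and there are only countably many such finite unions.
\<close>

lemma MC_space_finite_domain_compactness:
  assumes fin: "finite (UNIV :: 'x::t2_space set)"
  shows "locally_compact_space (euclidean :: 'y::{real_vector, metric_space} topology) \<Longrightarrow>
      locally_compact_space (MC_space :: ('x \<Rightarrow> 'y set) topology)"
    and "sigma_compact_space (euclidean :: 'y topology) \<Longrightarrow>
      sigma_compact_space (MC_space :: ('x \<Rightarrow> 'y set) topology)"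
proof -
  note hom = MC_space_finite_domain_homeomorphic[OF fin, where 'y = 'y]
  assume "locally_compact_space (euclidean :: 'y topology)"
  then have "locally_compact_space (product_topology (\<lambda>_. euclidean :: 'y topology) (UNIV :: 'x set))"
    unfolding locally_compact_space_product_topology using fin by (auto intro: rev_finite_subset)
  then show "locally_compact_space (MC_space :: ('x \<Rightarrow> 'y set) topology)"
    using homeomorphic_locally_compact_spaceD[OF _ homeomorphic_maps_imp_homeomorphic_space[OF hom]]
    by (simp add: euclidean_product_topology)
next
  note hom = MC_space_finite_domain_homeomorphic[OF fin, where 'y = 'y]
  assume "sigma_compact_space (euclidean :: 'y topology)"
  then obtain \<L> :: "'y set set" where \<L>: "countable \<L>" "\<And>L. L \<in> \<L> \<Longrightarrow> compact L" "\<Union>\<L> = UNIV"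
    by (auto simp: sigma_compact_space_def)
  define \<P> where "\<P> = (\<lambda>\<L>\<^sub>f. (\<Pi>\<^sub>E x\<in>(UNIV :: 'x set). \<Union>\<L>\<^sub>f)) ` {\<L>\<^sub>f. finite \<L>\<^sub>f \<and> \<L>\<^sub>f \<subseteq> \<L>}"
  have "sigma_compact_space (euclidean :: ('x \<Rightarrow> 'y) topology)"
    unfolding sigma_compact_space_def
  proof (intro exI[of _ \<P>] conjI ballI)
    show "countable \<P>"
      unfolding \<P>_def by (intro countable_image countable_Collect_finite_subset \<L>(1))
    fix P assume "P \<in> \<P>"
    then obtain \<L>\<^sub>f where "finite \<L>\<^sub>f" "\<L>\<^sub>f \<subseteq> \<L>" "P = (\<Pi>\<^sub>E x\<in>UNIV. \<Union>\<L>\<^sub>f)"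
      by (auto simp: \<P>_def)
    moreover from this have "compact (\<Union>\<L>\<^sub>f)"
      using \<L>(2) by (intro compact_Union) auto
    ultimately show "compactin euclidean P"
      using compactin_PiE[of "\<lambda>_. euclidean :: 'y topology" "UNIV :: 'x set" "\<lambda>_. \<Union>\<L>\<^sub>f"]
      by (simp add: euclidean_product_topology)
  next
    have "f \<in> \<Union>\<P>" for f
    proof -
      have "\<exists>l. l \<in> \<L> \<and> f x \<in> l" for x
        using \<L>(3) by (metis UNIV_I UnionE)
      then obtain l where l: "\<And>x. l x \<in> \<L> \<and> f x \<in> l x"
        by metis
      have "(\<Pi>\<^sub>E x\<in>UNIV. \<Union>(range l)) \<in> \<P>"
        unfolding \<P>_def using l fin by (intro imageI) auto
      moreover have "f \<in> (\<Pi>\<^sub>E x\<in>UNIV. \<Union>(range l))"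
        using l by auto
      ultimately show ?thesis by blast
    qed
    then show "\<Union>\<P> = topspace euclidean" by auto
  qed
  then show "sigma_compact_space (MC_space :: ('x \<Rightarrow> 'y set) topology)"
  proof (rule sigma_compact_space_continuous_image)
    show "continuous_map euclidean MC_space (\<lambda>(f :: 'x \<Rightarrow> 'y) x. {f x})"
      using hom by (simp add: homeomorphic_maps_def)
    show "(\<lambda>(f :: 'x \<Rightarrow> 'y) x. {f x}) ` topspace euclidean = topspace MC_space"
      using homeomorphic_imp_surjective_map[OF homeomorphic_maps_imp_map[OF hom]] .
  qed
qed

section \<open>The equivalences\<close>

text \<open>
  The scalar field is kept general so that the real and the complex case are instances of one
  statement.
\<close>

lemma MC_space_compactness_equivalences:
  fixes scl :: "'k::{real_normed_field, heine_borel} \<Rightarrow> 'y \<Rightarrow> 'y::{real_vector, metric_space, topological_ab_group_add}"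
  assumes lc: "locally_compact_space (euclidean :: 'x::t2_space topology)"
    and nontrivial: "\<exists>y z :: 'y. y \<noteq> z"
    and compl: "complete (UNIV :: 'y set)"
    and tvs: "locally_convex_tvs scl"
  shows "(locally_compact_space (MC_space :: ('x \<Rightarrow> 'y set) topology) \<longleftrightarrow>
           sigma_compact_space (MC_space :: ('x \<Rightarrow> 'y set) topology)) \<and>
        (sigma_compact_space (MC_space :: ('x \<Rightarrow> 'y set) topology) \<longleftrightarrow>
           locally_sigma_compact_space (MC_space :: ('x \<Rightarrow> 'y set) topology)) \<and>
        (locally_sigma_compact_space (MC_space :: ('x \<Rightarrow> 'y set) topology) \<longleftrightarrow>
           finite_dimensional scl \<and> finite (UNIV :: 'x set))"
proof -
  have vs: "vector_space scl" and scl_real: "\<And>r x. scl (of_real r) x = r *\<^sub>R x"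
    and scl_cont: "continuous_on UNIV (\<lambda>(a, y). scl a y)"
    using tvs by (simp_all add: locally_convex_tvs_def)
  interpret scl: vector_space scl by (rule vs)
  have scaleR: "continuous_on UNIV (\<lambda>(t :: real, y :: 'y). t *\<^sub>R y)"
  proof -
    have "continuous_on UNIV (\<lambda>p :: real \<times> 'y. (\<lambda>(a, y). scl a y) (of_real (fst p), snd p))"
      by (intro continuous_on_compose2[OF scl_cont] continuous_intros) auto
    then show ?thesis
      by (simp add: scl_real case_prod_unfold)
  qed
  let ?MC = "MC_space :: ('x \<Rightarrow> 'y set) topology"
  have "finite_dimensional scl \<and> finite (UNIV :: 'x set)" if ls: "locally_sigma_compact_space ?MC"
  proof
    obtain D :: "'y set" where D: "finite D" "span D = UNIV"
      using finite_span_if_locally_compact[OF scaleR locally_compact_codomain_if_locally_sigma_compact[OF compl ls]] .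
    have "subspace (scl.span D)"
      unfolding subspace_def
      using scl.span_zero scl.span_add scl.span_scale by (metis scl_real)
    then have "span D \<subseteq> scl.span D"
      using scl.span_superset by (intro span_minimal)
    then show "finite_dimensional scl"
      using D by (intro finite_dimensional_if_finite_span[OF vs D(1)]) auto
    show "finite (UNIV :: 'x set)"
      using finite_domain_if_locally_sigma_compact[OF scaleR nontrivial lc ls] .
  qed
  moreover have "locally_compact_space ?MC \<and> sigma_compact_space ?MC"
    if fd: "finite_dimensional scl" and fin: "finite (UNIV :: 'x set)"
  proof -
    obtain B where "finite_dimensional_vector_space scl B"
      using fd by (auto simp: finite_dimensional_def)
    then have "finite B" "scl.span B = UNIV"
      by (simp_all add: finite_dimensional_vector_space_def finite_dimensional_vector_space_axioms_def)
    then obtain L :: "nat \<Rightarrow> 'y set" where L: "\<And>i. compact (L i)" "UNIV = (\<Union>i. L i)"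
      using span_of_finite_set_sigma_compact[OF vs scl_cont] by metis
    then have "sigma_compact_space (euclidean :: 'y topology)"
      unfolding sigma_compact_space_def by (intro exI[of _ "range L"]) auto
    moreover obtain i b where "b \<in> interior (L i)"
      using compact_cover_of_ball_has_interior[OF compl, of L 1 0] L by auto
    then have "locally_compact_space (euclidean :: 'y topology)"
      using locally_compact_space_translation L(1) by blast
    ultimately show ?thesis
      using MC_space_finite_domain_compactness[OF fin] by blast
  qed
  ultimately show ?thesis
    using locally_compact_imp_locally_sigma_compact_space[of ?MC]
      sigma_compact_imp_locally_sigma_compact_space[of ?MC] by blast
qed

theorem corollary4p1:
  fixes scaleC :: "complex \<Rightarrow> 'y \<Rightarrow> 'y::{real_vector, metric_space, topological_ab_group_add}"
  assumes "locally_compact_space (euclidean :: 'x::t2_space topology)"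
    and "\<exists>y z :: 'y. y \<noteq> z"
    and "complete (UNIV :: 'y set)"
  shows
    "(locally_convex_tvs (scaleR :: real \<Rightarrow> 'y \<Rightarrow> 'y) \<longrightarrow>
        (locally_compact_space (MC_space :: ('x \<Rightarrow> 'y set) topology) \<longleftrightarrow>
           sigma_compact_space (MC_space :: ('x \<Rightarrow> 'y set) topology)) \<and>
        (sigma_compact_space (MC_space :: ('x \<Rightarrow> 'y set) topology) \<longleftrightarrow>
           locally_sigma_compact_space (MC_space :: ('x \<Rightarrow> 'y set) topology)) \<and>
        (locally_sigma_compact_space (MC_space :: ('x \<Rightarrow> 'y set) topology) \<longleftrightarrow>
           finite_dimensional (scaleR :: real \<Rightarrow> 'y \<Rightarrow> 'y) \<and> finite (UNIV :: 'x set)))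
     \<and>
     (locally_convex_tvs scaleC \<longrightarrow>
        (locally_compact_space (MC_space :: ('x \<Rightarrow> 'y set) topology) \<longleftrightarrow>
           sigma_compact_space (MC_space :: ('x \<Rightarrow> 'y set) topology)) \<and>
        (sigma_compact_space (MC_space :: ('x \<Rightarrow> 'y set) topology) \<longleftrightarrow>
           locally_sigma_compact_space (MC_space :: ('x \<Rightarrow> 'y set) topology)) \<and>
        (locally_sigma_compact_space (MC_space :: ('x \<Rightarrow> 'y set) topology) \<longleftrightarrow>
           finite_dimensional scaleC \<and> finite (UNIV :: 'x set)))"
  using MC_space_compactness_equivalences[OF assms, of scaleR] MC_space_compactness_equivalences[OF assms, of scaleC]
  by (intro conjI[of "_ \<longrightarrow> _"] impI)

end
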